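(* Let $r \ge 2$ be an integer. Let $\alpha \in (r-2, r-1)$, $p \in \left[1, \frac{1}{r-1-\alpha}\right)$, and $C > 0$ be real numbers. Then for every $\varepsilon\in (0,1)$, there exist constants $K$ and $N_0$ such that the following holds for every $n \ge N_0$. Suppose $\mathcal{G}$ is an $r$-graph on $n$ vertices with $\|\mathcal{G}\|_{p} \ge C n^{1+p \alpha}$. Then $\mathcal{G}$ contains a subgraph $\mathcal{H}$ on $m$ vertices satisfying (i) $\|\mathcal{H}\|_p \ge (1-\varepsilon)C m^{1+p \alpha}$, (ii) $m\ge \frac{\left(C^{1/\delta} n\right)^{\frac{\delta}{1-3\delta}}}{2}$, where $\delta := \frac{1 - p(r-1-\alpha)}{4}$, (iii) $\Delta(\mathcal{H}) \le \left(\frac{K}{1-\varepsilon}\cdot \frac{\|\mathcal{H}\|_p}{m} \right)^{1/p}$, and (iv) $|\mathcal{H}|> \hat{C} m^{1+\alpha}$, where $\hat{C} := \frac{(1-\varepsilon) C^{1/p}}{r K^{\frac{p-1}{p}}}$.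
   Context: An $r$-graph $\mathcal{H}$ is a finite $r$-uniform hypergraph, identified with its edge set, so $|\mathcal{H}|$ is its number of edges; $V(\mathcal{H})$ is its vertex set. The degree $d_{\mathcal{H}}(v)$ is the number of edges containing $v$, and $\Delta(\mathcal{H})$ is the maximum degree. For a real $p\ge 0$, $\|\mathcal{H}\|_p := \sum_{v\in V(\mathcal{H})} (d_{\mathcal{H}}(v))^{p}$. *)

theory Defs
  imports Complex_Main
begin

text \<open>The vertex set is a component of its own, so isolated vertices are allowed and count as vertices.\<close>

record 'a hypergraph =
  verts :: "'a set"
  edges :: "'a set set"

definition r_graph :: "nat \<Rightarrow> 'a hypergraph \<Rightarrow> bool" where
  "r_graph r H \<longleftrightarrow> finite (verts H) \<and> (\<forall>e\<in>edges H. e \<subseteq> verts H \<and> card e = r)"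

text \<open>Not necessarily induced: \<open>H\<close> may omit edges of \<open>G\<close> that lie inside its vertex set.\<close>

definition subgraph :: "'a hypergraph \<Rightarrow> 'a hypergraph \<Rightarrow> bool" where
  "subgraph H G \<longleftrightarrow> verts H \<subseteq> verts G \<and> edges H \<subseteq> edges G"

definition degree :: "'a hypergraph \<Rightarrow> 'a \<Rightarrow> nat" where
  "degree H v = card {e \<in> edges H. v \<in> e}"

text \<open>The added \<open>0\<close> only matters for a hypergraph without vertices, whose maximum degree is then 0.\<close>

definition max_degree :: "'a hypergraph \<Rightarrow> nat" where
  "max_degree H = Max (insert 0 (degree H ` verts H))"

text \<open>
  \<open>0 powr p = 0\<close> also for \<open>p = 0\<close>, so isolated vertices contribute nothing for any exponent.
\<close>

definition degree_norm :: "real \<Rightarrow> 'a hypergraph \<Rightarrow> real" where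
  "degree_norm p H = (\<Sum>v\<in>verts H. real (degree H v) powr p)"

end

theory Submission
  imports Defs "HOL-Analysis.Convex"
begin

text \<open>
  Put \<open>\<gamma> = 1 + p * \<alpha> - \<delta> = p * (r - 1) + 3 * \<delta>\<close>, and among the nonempty vertex sets of
  \<open>G\<close> let \<open>W\<close> maximise \<open>\<parallel>G[W]\<parallel>\<^sub>p / |W|\<^sup>\<gamma>\<close>. Write \<open>H = G[W]\<close> and \<open>m = |W|\<close>. Comparing \<open>W\<close>
  with the whole vertex set gives \<open>\<parallel>H\<parallel>\<^sub>p \<ge> C * n\<^sup>\<delta> * m\<^sup>\<gamma>\<close>. As \<open>n \<ge> m\<close>, this is at least
  \<open>C * m powr (1 + p * \<alpha>)\<close>, and comparison with the trivial bound
  \<open>\<parallel>H\<parallel>\<^sub>p \<le> m powr (1 + p * (r - 1))\<close> forces \<open>m\<close> to be large (\<open>extremal_subgraph\<close>).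

  Extremality also makes the vertices of high degree negligible. Let \<open>A\<close> consist of the
  vertices whose \<open>p\<close>-th power of the degree exceeds \<open>t\<close> times the average \<open>\<parallel>H\<parallel>\<^sub>p / m\<close>, so that
  \<open>|A| \<le> m / t\<close>. Cut the vertex set into \<open>t\<close> blocks of about \<open>m / t\<close> vertices. An edge meeting
  \<open>A\<close> has at most \<open>r - 1\<close> vertices outside \<open>A\<close>, hence lies inside \<open>A\<close> together with \<open>r - 1\<close>
  blocks; this covers the edges meeting \<open>A\<close> by \<open>t ^ (r - 1)\<close> subgraphs of \<open>H\<close>
  induced on sets of at most \<open>2 * r * m / t\<close> vertices. By extremality the norm of each is at
  most \<open>(2 * r / t)\<^sup>\<gamma> * \<parallel>H\<parallel>\<^sub>p\<close>, and convexity of the \<open>p\<close>-th power adds them up to at most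
  \<open>(2 * r)\<^sup>\<gamma> * t powr (p * (r - 1) - \<gamma>) * \<parallel>H\<parallel>\<^sub>p\<close>, where the exponent of \<open>t\<close> is \<open>- 3 * \<delta>\<close>
  (\<open>degree_norm_edges_meeting\<close>). For \<open>t\<close> large in terms of \<open>r\<close>, \<open>p\<close>, \<open>\<alpha>\<close> and \<open>\<epsilon>\<close> this is a tiny
  fraction of \<open>\<parallel>H\<parallel>\<^sub>p\<close>.

  So deleting all edges that meet \<open>A\<close>, while keeping all vertices, costs little of the norm and
  leaves a graph whose maximum degree obeys the required bound with \<open>K = t\<close>
  (\<open>delete_high_degree\<close>). The edge count follows from the degree bound, since
  \<open>\<Sum> d\<^sup>p\<close> is at most \<open>\<Sum> d = r * |E|\<close> times the \<open>(p - 1)\<close>-st power of the maximum degree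
  (\<open>card_edges_gt\<close>); it comes out strict because the norm was kept strictly above
  \<open>(1 - \<epsilon>) * C * m powr (1 + p * \<alpha>)\<close>.
\<close>

section \<open>Degree norms\<close>

text \<open>
  Convexity of \<open>x powr p\<close> is used on the positive reals, so the zero summands are
  discarded before Jensen's inequality is applied with equal weights; dropping them only lowers the
  number of terms.
\<close>

lemma power_mean_powr:
  fixes x :: "'i \<Rightarrow> real"
  assumes fin: "finite I" and nn: "\<And>i. i \<in> I \<Longrightarrow> 0 \<le> x i" and p: "1 \<le> p"
  shows "(\<Sum>i\<in>I. x i) powr p \<le> real (card I) powr (p - 1) * (\<Sum>i\<in>I. x i powr p)"
proof -
  define J where "J = {i \<in> I. 0 < x i}"
  have JI: "J \<subseteq> I" and finJ: "finite J" using fin by (auto simp: J_def)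
  have s1: "(\<Sum>i\<in>I. x i) = (\<Sum>i\<in>J. x i)"
    using fin nn by (intro sum.mono_neutral_right) (force simp: J_def)+
  have s2: "(\<Sum>i\<in>I. x i powr p) = (\<Sum>i\<in>J. x i powr p)"
    using fin nn by (intro sum.mono_neutral_right) (force simp: J_def)+
  show ?thesis
  proof (cases "J = {}")
    case True
    then show ?thesis by (simp add: s1 s2)
  next
    case False
    define N where "N = real (card J)"
    have N: "0 < N" using False finJ by (simp add: N_def card_gt_0_iff)
    have "(\<Sum>i\<in>J. (1 / N) *\<^sub>R x i) powr p \<le> (\<Sum>i\<in>J. (1 / N) * x i powr p)"
      by (rule convex_on_sum[OF finJ False powr_convex[OF p], where a = "\<lambda>_. 1 / N"])
        (use N in \<open>auto simp: N_def J_def\<close>)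
    then have "((\<Sum>i\<in>J. x i) / N) powr p \<le> (\<Sum>i\<in>J. x i powr p) / N"
      by (simp add: sum_divide_distrib)
    moreover have "((\<Sum>i\<in>J. x i) / N) powr p = (\<Sum>i\<in>J. x i) powr p / N powr p"
      by (rule powr_divide)
    ultimately have "(\<Sum>i\<in>J. x i) powr p \<le> N powr p / N * (\<Sum>i\<in>J. x i powr p)"
      using N by (simp add: field_simps)
    also have "N powr p / N = N powr (p - 1)"
      using N by (simp add: powr_diff)
    also have "\<dots> * (\<Sum>i\<in>J. x i powr p) \<le> real (card I) powr (p - 1) * (\<Sum>i\<in>J. x i powr p)"
      using N p card_mono[OF fin JI]
      by (intro mult_right_mono powr_mono2 sum_nonneg) (auto simp: N_def)
    finally show ?thesis by (simp add: s1 s2)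
  qed
qed

lemma finite_edges: "r_graph r H \<Longrightarrow> finite (edges H)"
  unfolding r_graph_def by (rule finite_subset[of _ "Pow (verts H)"]) auto

lemma finite_verts: "r_graph r H \<Longrightarrow> finite (verts H)"
  by (simp add: r_graph_def)

lemma r_graph_subgraph:
  assumes "r_graph r H" "verts F \<subseteq> verts H" "edges F \<subseteq> edges H" "\<Union>(edges F) \<subseteq> verts F"
  shows "r_graph r F"
  using assms unfolding r_graph_def by (auto intro: finite_subset)

lemma degree_norm_nonneg: "0 \<le> degree_norm p H"
  by (auto simp: degree_norm_def intro: sum_nonneg)

lemma degree_norm_superset:
  assumes "r_graph r F" "verts F \<subseteq> V" "finite V"
  shows "degree_norm p F = (\<Sum>v\<in>V. real (degree F v) powr p)"
proof -
  have "degree F v = 0" if "v \<notin> verts F" for v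
  proof -
    have none: "{e \<in> edges F. v \<in> e} = {}" using assms(1) that by (auto simp: r_graph_def)
    show ?thesis unfolding degree_def none by simp
  qed
  then show ?thesis
    unfolding degree_norm_def using assms by (intro sum.mono_neutral_left) auto
qed

text \<open>
  The degree of a vertex is at most the sum of its degrees in the covering graphs, so the power
  mean inequality applies vertex by vertex. The exponent \<open>p - 1\<close>, rather than \<open>p\<close>, on the number of
  graphs is what lets a cover by \<open>t ^ (r - 1)\<close> graphs cost only \<open>t\<close> to the power \<open>p * (r - 1)\<close> when
  all the norms are equal.
\<close>

lemma degree_norm_cover:
  assumes r: "\<And>i. i \<in> I \<Longrightarrow> r_graph r (F i)" and fin: "finite I" "finite (verts H)"
    and cov: "edges H \<subseteq> (\<Union>i\<in>I. edges (F i))"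
    and sub: "\<And>i. i \<in> I \<Longrightarrow> verts (F i) \<subseteq> verts H"
    and p: "1 \<le> p"
  shows "degree_norm p H \<le> real (card I) powr (p - 1) * (\<Sum>i\<in>I. degree_norm p (F i))"
proof -
  have deg: "degree H v \<le> (\<Sum>i\<in>I. degree (F i) v)" for v
  proof -
    have "degree H v \<le> card (\<Union>i\<in>I. {e \<in> edges (F i). v \<in> e})"
      unfolding degree_def using cov fin finite_edges[OF r] by (intro card_mono) auto
    also have "\<dots> \<le> (\<Sum>i\<in>I. degree (F i) v)"
      unfolding degree_def using fin by (intro card_UN_le)
    finally show ?thesis .
  qed
  have "degree_norm p H \<le> (\<Sum>v\<in>verts H. real (\<Sum>i\<in>I. degree (F i) v) powr p)"
    unfolding degree_norm_def using deg p by (intro sum_mono powr_mono2) (auto simp del: of_nat_sum)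
  also have "\<dots> \<le> (\<Sum>v\<in>verts H. real (card I) powr (p - 1) * (\<Sum>i\<in>I. real (degree (F i) v) powr p))"
    unfolding of_nat_sum using fin p by (intro sum_mono power_mean_powr) auto
  also have "\<dots> = real (card I) powr (p - 1) * (\<Sum>i\<in>I. \<Sum>v\<in>verts H. real (degree (F i) v) powr p)"
    by (subst sum.swap) (simp add: sum_distrib_left)
  also have "(\<Sum>i\<in>I. \<Sum>v\<in>verts H. real (degree (F i) v) powr p) = (\<Sum>i\<in>I. degree_norm p (F i))"
    using degree_norm_superset[OF r sub fin(2)] by (intro sum.cong) auto
  finally show ?thesis .
qed

text \<open>
  At each vertex either the part in \<open>F2\<close> exceeds the fraction \<open>l\<close> of the degree, or the part in
  \<open>F1\<close> is at least the fraction \<open>1 - l\<close> of it; the corresponding summand alone bounds the left-hand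
  side. The lemma serves with \<open>F2\<close> of very small norm, when it says that \<open>F1\<close> carries almost all
  of the norm.
\<close>

lemma degree_norm_split:
  assumes "r_graph r F1" "r_graph r F2" "verts F1 = verts H" "verts F2 = verts H"
    and un: "edges H \<subseteq> edges F1 \<union> edges F2" and p: "1 \<le> p" and l: "0 < l" "l < 1"
  shows "degree_norm p H \<le> degree_norm p F1 / (1 - l) powr p + degree_norm p F2 / l powr p"
proof -
  have "real (degree H v) powr p
      \<le> real (degree F1 v) powr p / (1 - l) powr p + real (degree F2 v) powr p / l powr p" for v
  proof -
    have "degree H v \<le> card ({e \<in> edges F1. v \<in> e} \<union> {e \<in> edges F2. v \<in> e})"
      unfolding degree_def using un finite_edges[OF assms(1)] finite_edges[OF assms(2)]
      by (intro card_mono) auto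
    also have "\<dots> \<le> degree F1 v + degree F2 v"
      unfolding degree_def by (rule card_Un_le)
    finally have d: "real (degree H v) \<le> real (degree F1 v) + real (degree F2 v)" by linarith
    show ?thesis
    proof (cases "real (degree F2 v) \<le> l * real (degree H v)")
      case True
      then have "(1 - l) * real (degree H v) \<le> real (degree F1 v)"
        using d by (simp add: algebra_simps)
      then have "((1 - l) * real (degree H v)) powr p \<le> real (degree F1 v) powr p"
        using l p by (intro powr_mono2) auto
      then have "real (degree H v) powr p \<le> real (degree F1 v) powr p / (1 - l) powr p"
        using l unfolding powr_mult by (simp add: pos_le_divide_eq mult.commute)
      then show ?thesis by (simp add: add_increasing2)
    next
      case False
      then have "(l * real (degree H v)) powr p \<le> real (degree F2 v) powr p"
        using l p by (intro powr_mono2) auto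
      then have "real (degree H v) powr p \<le> real (degree F2 v) powr p / l powr p"
        using l unfolding powr_mult by (simp add: pos_le_divide_eq mult.commute)
      then show ?thesis by (simp add: add_increasing)
    qed
  qed
  then have "degree_norm p H \<le> (\<Sum>v\<in>verts H. real (degree F1 v) powr p / (1 - l) powr p
      + real (degree F2 v) powr p / l powr p)"
    unfolding degree_norm_def by (rule sum_mono)
  also have "\<dots> = degree_norm p F1 / (1 - l) powr p + degree_norm p F2 / l powr p"
    using assms(3,4) by (simp add: degree_norm_def sum.distrib sum_divide_distrib)
  finally show ?thesis .
qed

lemma degree_le:
  assumes "r_graph r H"
  shows "degree H v \<le> card (verts H) ^ (r - 1)"
proof -
  have "degree H v \<le> card {S. S \<subseteq> verts H \<and> card S = r - 1}"
    unfolding degree_def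
  proof (rule card_inj_on_le)
    show "inj_on (\<lambda>e. e - {v}) {e \<in> edges H. v \<in> e}" by (auto simp: inj_on_def)
    show "(\<lambda>e. e - {v}) ` {e \<in> edges H. v \<in> e} \<subseteq> {S. S \<subseteq> verts H \<and> card S = r - 1}"
      using assms by (auto simp: r_graph_def)
    show "finite {S. S \<subseteq> verts H \<and> card S = r - 1}" using finite_verts[OF assms] by simp
  qed
  also have "\<dots> = card (verts H) choose (r - 1)"
    using finite_verts[OF assms] by (rule n_subsets)
  also have "\<dots> \<le> (card (verts H) choose (r - 1)) * fact (r - 1)" by simp
  also have "\<dots> \<le> card (verts H) ^ (r - 1)" by (rule binomial_fact_pow)
  finally show ?thesis .
qed

lemma degree_norm_le:
  assumes "r_graph r H" "1 \<le> r" "0 \<le> p" "0 < card (verts H)"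
  shows "degree_norm p H \<le> real (card (verts H)) powr (1 + p * (real r - 1))"
proof -
  let ?m = "real (card (verts H))"
  have "real (degree H v) powr p \<le> ?m powr (p * (real r - 1))" for v
  proof -
    have "real (degree H v) powr p \<le> (?m ^ (r - 1)) powr p"
      using degree_le[OF assms(1), of v] assms(3)
      by (intro powr_mono2) (auto simp flip: of_nat_power)
    also have "\<dots> = ?m powr (p * (real r - 1))"
      using assms by (simp add: powr_powr of_nat_diff mult.commute flip: powr_realpow)
    finally show ?thesis .
  qed
  then have "degree_norm p H \<le> ?m * ?m powr (p * (real r - 1))"
    unfolding degree_norm_def by (intro sum_bounded_above)
  then show ?thesis using assms(4) by (simp add: powr_add)
qed

lemma sum_degree:
  assumes "r_graph r H"
  shows "(\<Sum>v\<in>verts H. degree H v) = r * card (edges H)"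
proof -
  have "(\<Sum>v\<in>verts H. degree H v) = (\<Sum>v\<in>verts H. \<Sum>e\<in>edges H. if v \<in> e then 1 else 0)"
    using finite_edges[OF assms] by (simp add: degree_def flip: sum.inter_filter)
  also have "\<dots> = (\<Sum>e\<in>edges H. \<Sum>v\<in>verts H. if v \<in> e then 1 else 0)" by (rule sum.swap)
  also have "\<dots> = (\<Sum>e\<in>edges H. r)"
  proof (rule sum.cong)
    fix e assume "e \<in> edges H"
    then have "{v \<in> verts H. v \<in> e} = e" "card e = r" using assms by (auto simp: r_graph_def)
    then show "(\<Sum>v\<in>verts H. if v \<in> e then 1 else 0) = r"
      using finite_verts[OF assms] by (simp flip: sum.inter_filter)
  qed simp
  finally show ?thesis by (simp add: mult.commute)
qed

lemma max_degree_le: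
  assumes "finite (verts H)" "0 \<le> b" "\<And>v. v \<in> verts H \<Longrightarrow> real (degree H v) \<le> b"
  shows "real (max_degree H) \<le> b"
proof -
  have "max_degree H \<in> insert 0 (degree H ` verts H)"
    unfolding max_degree_def using assms(1) by (intro Max_in) auto
  then show ?thesis using assms by auto
qed

lemma degree_le_max_degree: "finite (verts H) \<Longrightarrow> v \<in> verts H \<Longrightarrow> degree H v \<le> max_degree H"
  unfolding max_degree_def by (intro Max_ge) auto

text \<open>
  Handshaking, with \<open>p - 1\<close> of the \<open>p\<close> factors of each summand bounded by the maximum degree.
\<close>

lemma degree_norm_le_edges:
  assumes "r_graph r H" "1 \<le> p"
  shows "degree_norm p H \<le> real (max_degree H) powr (p - 1) * (real r * real (card (edges H)))"
proof -
  have "degree_norm p H \<le> (\<Sum>v\<in>verts H. real (max_degree H) powr (p - 1) * real (degree H v))"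
    unfolding degree_norm_def
  proof (rule sum_mono)
    fix v assume v: "v \<in> verts H"
    show "real (degree H v) powr p \<le> real (max_degree H) powr (p - 1) * real (degree H v)"
    proof (cases "degree H v = 0")
      case False
      then have "real (degree H v) powr p = real (degree H v) powr (p - 1) * real (degree H v)"
        by (simp add: powr_diff)
      also have "\<dots> \<le> real (max_degree H) powr (p - 1) * real (degree H v)"
        using degree_le_max_degree[OF finite_verts[OF assms(1)] v] assms(2)
        by (intro mult_right_mono powr_mono2) auto
      finally show ?thesis .
    qed simp
  qed
  also have "\<dots> = real (max_degree H) powr (p - 1) * real (\<Sum>v\<in>verts H. degree H v)"
    by (simp add: sum_distrib_left)
  finally show ?thesis by (simp add: sum_degree[OF assms(1)])
qed

section \<open>Covering the edges that meet a small vertex set\<close>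

definition induced :: "'a hypergraph \<Rightarrow> 'a set \<Rightarrow> 'a hypergraph" where
  "induced H W = \<lparr>verts = W, edges = {e \<in> edges H. e \<subseteq> W}\<rparr>"

definition edges_meeting :: "'a hypergraph \<Rightarrow> 'a set \<Rightarrow> 'a hypergraph" where
  "edges_meeting H A = \<lparr>verts = verts H, edges = {e \<in> edges H. e \<inter> A \<noteq> {}}\<rparr>"

definition edges_avoiding :: "'a hypergraph \<Rightarrow> 'a set \<Rightarrow> 'a hypergraph" where
  "edges_avoiding H A = \<lparr>verts = verts H, edges = {e \<in> edges H. e \<inter> A = {}}\<rparr>"

lemma r_graph_induced: "r_graph r H \<Longrightarrow> W \<subseteq> verts H \<Longrightarrow> r_graph r (induced H W)"
  by (rule r_graph_subgraph[of r H]) (auto simp: induced_def)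

lemma r_graph_edges_meeting: "r_graph r H \<Longrightarrow> r_graph r (edges_meeting H A)"
  by (auto simp: r_graph_def edges_meeting_def)

lemma r_graph_edges_avoiding: "r_graph r H \<Longrightarrow> r_graph r (edges_avoiding H A)"
  by (auto simp: r_graph_def edges_avoiding_def)

text \<open>
  Number the vertices and colour the consecutive blocks of length \<open>card V div t + 1\<close>; that
  length is more than \<open>card V / t\<close>, so \<open>t\<close> blocks suffice.
\<close>

lemma equitable_colouring:
  fixes t :: nat
  assumes "finite V" "0 < t"
  obtains c :: "'a \<Rightarrow> nat" where "\<And>v. v \<in> V \<Longrightarrow> c v < t"
    and "\<And>j. card {v \<in> V. c v = j} \<le> card V div t + 1"
proof -
  define b where "b = card V div t + 1"
  obtain h where h: "bij_betw h V {0..<card V}"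
    using ex_bij_betw_finite_nat[OF assms(1)] by blast
  have "card V < t * b"
    using assms(2) by (simp add: b_def dividend_less_times_div)
  have b: "0 < b" by (simp add: b_def)
  then have "h v div b < t" if "v \<in> V" for v
  proof -
    have "h v < card V" using bij_betwE[OF h] that by auto
    then show ?thesis using \<open>card V < t * b\<close> by (intro less_mult_imp_div_less) linarith
  qed
  moreover have "card {v \<in> V. h v div b = j} \<le> card V div t + 1" for j
  proof -
    have "card {v \<in> V. h v div b = j} \<le> card {j * b..<j * b + b}"
    proof (rule card_inj_on_le[where f = h])
      show "inj_on h {v \<in> V. h v div b = j}"
        using h by (auto simp: bij_betw_def inj_on_def)
      have "h v \<in> {h v div b * b..<h v div b * b + b}" for v
        unfolding atLeastLessThan_iff
        using div_mult_mod_eq[of "h v" b] mod_less_divisor[OF b, of "h v"] by linarith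
      then show "h ` {v \<in> V. h v div b = j} \<subseteq> {j * b..<j * b + b}" by blast
    qed simp
    then show ?thesis by (simp add: b_def)
  qed
  ultimately show ?thesis by (rule that)
qed

text \<open>
  The covering argument. The assumption \<open>ext\<close> says that \<open>H\<close> is extremal, and a small set \<open>A\<close>
  then cannot attract many edges: joined to \<open>r - 1\<close> colour classes it would induce too dense a
  graph. When \<open>\<gamma>\<close> exceeds \<open>p * (r - 1)\<close> the bound tends to 0 as \<open>t\<close> grows. The factor \<open>2 * r\<close>
  absorbs both the set \<open>A\<close> and the rounding in the sizes of the colour classes.
\<close>

lemma degree_norm_edges_meeting:
  fixes t :: nat and p \<gamma> :: real
  assumes rH: "r_graph r H" and r: "1 \<le> r" and p: "1 \<le> p" and \<gamma>: "0 \<le> \<gamma>"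
    and t: "0 < t"
    and ext: "\<And>W. W \<subseteq> verts H \<Longrightarrow>
      degree_norm p (induced H W) \<le> (real (card W) / real (card (verts H))) powr \<gamma> * degree_norm p H"
    and A: "A \<subseteq> verts H" "real (card A) \<le> real (card (verts H)) / real t"
  shows "degree_norm p (edges_meeting H A)
    \<le> (2 * real r) powr \<gamma> * real t powr (p * (real r - 1) - \<gamma>) * degree_norm p H"
proof (cases "A = {}")
  case True
  then have "degree_norm p (edges_meeting H A) = 0"
    by (simp add: degree_norm_def edges_meeting_def degree_def)
  then show ?thesis by (simp add: degree_norm_nonneg)
next
  case False
  let ?m = "card (verts H)"
  note fV = finite_verts[OF rH]
  have fA: "finite A" using A(1) fV by (rule finite_subset)
  \<comment> \<open>A nonempty \<open>A\<close> forces \<open>t \<le> m\<close>, so a class of \<open>m div t + 1\<close> vertices has at most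
    \<open>2 * m / t\<close> of them.\<close>
  have "1 \<le> card A" using False fA by (simp add: Suc_le_eq card_gt_0_iff)
  then have "1 \<le> real ?m / real t" using A(2) by linarith
  then have tm: "real t \<le> real ?m" using t by (simp add: field_simps)
  have m: "0 < ?m" using tm t by linarith
  obtain c :: "'a \<Rightarrow> nat" where c: "\<And>v. v \<in> verts H \<Longrightarrow> c v < t"
    and cc: "\<And>j. card {v \<in> verts H. c v = j} \<le> ?m div t + 1"
    using equitable_colouring[OF fV t] by blast
  \<comment> \<open>Lists allow repeated colours, so one index set serves all edges, however many of their
    vertices lie in \<open>A\<close> or share a colour.\<close>
  define I where "I = {js. set js \<subseteq> {..<t} \<and> length js = r - 1}"
  define W where "W js = A \<union> {v \<in> verts H. c v \<in> set js}" for js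
  have cardI: "card I = t ^ (r - 1)" and finI: "finite I"
    by (simp_all add: I_def card_lists_length_eq finite_lists_length_eq)
  have Wsub: "W js \<subseteq> verts H" for js using A by (auto simp: W_def)
  have Wcard: "real (card (W js)) \<le> 2 * real r * (real ?m / real t)" if "js \<in> I" for js
  proof -
    have "{v \<in> verts H. c v \<in> set js} = (\<Union>j\<in>set js. {v \<in> verts H. c v = j})" by auto
    then have "card {v \<in> verts H. c v \<in> set js} \<le> (\<Sum>j\<in>set js. card {v \<in> verts H. c v = j})"
      by (simp add: card_UN_le)
    also have "\<dots> \<le> card (set js) * (?m div t + 1)"
      using sum_bounded_above[of "set js" "\<lambda>j. card {v \<in> verts H. c v = j}" "?m div t + 1"] cc by simp
    also have "\<dots> \<le> (r - 1) * (?m div t + 1)"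
      using card_length[of js] that by (intro mult_right_mono) (auto simp: I_def)
    finally have "card (W js) \<le> card A + (r - 1) * (?m div t + 1)"
      unfolding W_def using card_Un_le[of A "{v \<in> verts H. c v \<in> set js}"] by linarith
    then have "real (card (W js)) \<le> real (card A + (r - 1) * (?m div t + 1))"
      by (simp only: of_nat_le_iff)
    also have "\<dots> = real (card A) + (real r - 1) * (real (?m div t) + 1)"
      unfolding of_nat_add of_nat_mult of_nat_diff[OF r] by simp
    also have "\<dots> \<le> real ?m / real t + (real r - 1) * (real ?m / real t + real ?m / real t)"
      using A(2) \<open>1 \<le> real ?m / real t\<close> r of_nat_div_le_of_nat[of ?m t]
      by (intro add_mono mult_left_mono) auto
    also have "\<dots> = (2 * real r - 1) * (real ?m / real t)"
      using t by (simp add: field_simps)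
    also have "\<dots> \<le> 2 * real r * (real ?m / real t)"
      by (intro mult_right_mono) auto
    finally show ?thesis .
  qed
  have cov: "edges (edges_meeting H A) \<subseteq> (\<Union>js\<in>I. edges (induced H (W js)))"
  proof
    fix e assume "e \<in> edges (edges_meeting H A)"
    then have e: "e \<in> edges H" "e \<inter> A \<noteq> {}" by (auto simp: edges_meeting_def)
    have eV: "e \<subseteq> verts H" "card e = r" using rH e by (auto simp: r_graph_def)
    have fe: "finite e" using eV fV by (auto intro: finite_subset)
    have "e - A \<subset> e" using e by auto
    then have "card (e - A) < r" using psubset_card_mono[OF fe] eV by simp
    obtain xs where xs: "set xs = e - A" "distinct xs" using fe finite_distinct_list[of "e - A"] by auto
    have lxs: "length xs \<le> r - 1" using xs \<open>card (e - A) < r\<close> distinct_card[of xs] by simp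
    \<comment> \<open>An edge with several vertices in \<open>A\<close> gives too few colours; the list is padded with 0.\<close>
    define js where "js = map c xs @ replicate (r - 1 - length xs) 0"
    have "js \<in> I" using xs lxs eV c t by (auto simp: I_def js_def)
    moreover have "e \<subseteq> W js" using xs eV by (auto simp: W_def js_def)
    ultimately show "e \<in> (\<Union>js\<in>I. edges (induced H (W js)))" using e by (auto simp: induced_def)
  qed
  have "(\<Sum>js\<in>I. degree_norm p (induced H (W js)))
      \<le> (\<Sum>js\<in>I. (2 * real r / real t) powr \<gamma> * degree_norm p H)"
  proof (rule sum_mono)
    fix js assume "js \<in> I"
    have "real (card (W js)) / real ?m \<le> 2 * real r / real t"
      using Wcard[OF \<open>js \<in> I\<close>] m by (simp add: field_simps)
    then have "(real (card (W js)) / real ?m) powr \<gamma> \<le> (2 * real r / real t) powr \<gamma>"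
      using \<gamma> by (intro powr_mono2) auto
    then show "degree_norm p (induced H (W js)) \<le> (2 * real r / real t) powr \<gamma> * degree_norm p H"
      using ext[OF Wsub, of js] mult_right_mono[OF _ degree_norm_nonneg] by (meson order_trans)
  qed
  then have sum_le: "(\<Sum>js\<in>I. degree_norm p (induced H (W js)))
      \<le> real (card I) * ((2 * real r / real t) powr \<gamma> * degree_norm p H)" by simp
  have "degree_norm p (edges_meeting H A)
      \<le> real (card I) powr (p - 1) * (\<Sum>js\<in>I. degree_norm p (induced H (W js)))"
    using fV finI cov p Wsub r_graph_induced[OF rH Wsub]
    by (intro degree_norm_cover[where r = r]) (auto simp: edges_meeting_def induced_def)
  also have "\<dots> \<le> real (card I) powr (p - 1)
      * (real (card I) * ((2 * real r / real t) powr \<gamma> * degree_norm p H))"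
    by (intro mult_left_mono sum_le) auto
  also have "\<dots> = real (card I) powr p * (2 * real r / real t) powr \<gamma> * degree_norm p H"
    using t by (simp add: cardI powr_diff)
  also have "real (card I) powr p = real t powr (p * (real r - 1))"
    using t r by (simp add: cardI powr_powr of_nat_diff mult.commute flip: powr_realpow)
  also have "(2 * real r / real t) powr \<gamma> = (2 * real r) powr \<gamma> * real t powr (- \<gamma>)"
    by (simp add: powr_divide powr_minus_divide)
  finally show ?thesis
    by (simp add: powr_diff powr_minus_divide mult_ac)
qed

section \<open>Extremal vertex sets\<close>

text \<open>
  A maximiser of the norm divided by the \<open>\<gamma>\<close>-th power of the order. The empty set is left out of the
  competition, where its quotient would be 0 by 0, and satisfies the final inequality since its
  norm is 0.
\<close>

lemma exists_extremal_set:
  assumes "finite V" "V \<noteq> {}"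
  obtains W where "W \<subseteq> V" "W \<noteq> {}"
    and "degree_norm p (induced G W)
      \<ge> (real (card W) / real (card V)) powr \<gamma> * degree_norm p (induced G V)"
    and "\<And>U. U \<subseteq> W \<Longrightarrow>
      degree_norm p (induced G U) \<le> (real (card U) / real (card W)) powr \<gamma> * degree_norm p (induced G W)"
proof -
  define f where "f U = degree_norm p (induced G U) / real (card U) powr \<gamma>" for U
  define \<W> where "\<W> = Pow V - {{}}"
  have fin: "finite \<W>" and ne: "\<W> \<noteq> {}" using assms by (auto simp: \<W>_def)
  obtain W where W: "W \<in> \<W>" and max: "\<And>U. U \<in> \<W> \<Longrightarrow> f U \<le> f W"
  proof -
    have "Max (f ` \<W>) \<in> f ` \<W>" using fin ne by (intro Max_in) auto
    then obtain W where "W \<in> \<W>" "f W = Max (f ` \<W>)" by auto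
    then show thesis using that fin by simp
  qed
  have pos: "0 < real (card U) powr \<gamma>" if "U \<in> \<W>" for U
    using that assms by (auto simp: \<W>_def card_gt_0_iff intro: finite_subset)
  have cmp: "degree_norm p (induced G U) \<le> (real (card U) / real (card W)) powr \<gamma> * degree_norm p (induced G W)"
    if "U \<in> \<W>" for U
    using max[OF that] pos[OF that] pos[OF W] by (simp add: f_def powr_divide field_simps)
  show ?thesis
  proof
    show "W \<subseteq> V" "W \<noteq> {}" using W by (auto simp: \<W>_def)
    show "degree_norm p (induced G W)
      \<ge> (real (card W) / real (card V)) powr \<gamma> * degree_norm p (induced G V)"
      using cmp[of V] pos[OF W] pos[of V] assms by (simp add: \<W>_def powr_divide field_simps)
    show "degree_norm p (induced G U) \<le> (real (card U) / real (card W)) powr \<gamma> * degree_norm p (induced G W)"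
      if "U \<subseteq> W" for U
    proof (cases "U = {}")
      case True
      then show ?thesis by (simp add: degree_norm_def induced_def)
    next
      case False
      then show ?thesis using cmp W that by (auto simp: \<W>_def)
    qed
  qed
qed

section \<open>Deleting the high-degree vertices\<close>

text \<open>
  Markov's inequality for the \<open>p\<close>-th powers of the degrees.
\<close>

lemma card_high_degree:
  assumes "finite (verts H)" "0 < degree_norm p H" "0 < K" "verts H \<noteq> {}"
  shows "real (card {v \<in> verts H. K * degree_norm p H / real (card (verts H)) < real (degree H v) powr p})
    \<le> real (card (verts H)) / K"
proof -
  let ?m = "real (card (verts H))"
  let ?N = "degree_norm p H"
  define A where "A = {v \<in> verts H. K * ?N / ?m < real (degree H v) powr p}"
  have m: "0 < ?m" using assms by (simp add: card_gt_0_iff)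
  have "real (card A) * (K * ?N / ?m) \<le> (\<Sum>v\<in>A. real (degree H v) powr p)"
    using sum_bounded_below[of A "K * ?N / ?m" "\<lambda>v. real (degree H v) powr p"]
    by (force simp: A_def)
  also have "\<dots> \<le> ?N"
    unfolding degree_norm_def using assms(1) by (intro sum_mono2) (auto simp: A_def)
  finally have "real (card A) * K * ?N \<le> ?m * ?N" using m by (simp add: field_simps)
  then have "real (card A) * K \<le> ?m" using assms(2) by simp
  then show ?thesis using assms(3) by (simp add: A_def field_simps)
qed

text \<open>
  In the hypothesis \<open>t_large\<close> the number \<open>l = 1 - (1 - \<eta>) powr (1 / p)\<close> is chosen so that
  \<open>(1 - l) powr p = 1 - \<eta>\<close>. Then splitting off the edges that meet high-degree vertices costs one
  factor \<open>1 - \<eta>\<close> for the threshold \<open>l\<close> and another for the norm of these edges.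
\<close>

lemma delete_high_degree:
  fixes t :: nat and p \<gamma> \<eta> :: real
  assumes rH: "r_graph r H" and r: "1 \<le> r" and p: "1 \<le> p" and \<gamma>: "0 \<le> \<gamma>"
    and t: "0 < t" and \<eta>: "0 < \<eta>" "\<eta> < 1" and N: "0 < degree_norm p H" "verts H \<noteq> {}"
    and ext: "\<And>W. W \<subseteq> verts H \<Longrightarrow>
      degree_norm p (induced H W) \<le> (real (card W) / real (card (verts H))) powr \<gamma> * degree_norm p H"
    and t_large: "(2 * real r) powr \<gamma> * real t powr (p * (real r - 1) - \<gamma>)
      \<le> \<eta> * (1 - (1 - \<eta>) powr (1 / p)) powr p"
  obtains F where "r_graph r F" "subgraph F H" "verts F = verts H"
    and "(1 - \<eta>)\<^sup>2 * degree_norm p H \<le> degree_norm p F"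
    and "\<And>v. real (degree F v) powr p \<le> real t * degree_norm p H / real (card (verts H))"
proof -
  let ?m = "real (card (verts H))"
  let ?N = "degree_norm p H"
  define A where "A = {v \<in> verts H. real t * ?N / ?m < real (degree H v) powr p}"
  define F where "F = edges_avoiding H A"
  define l where "l = 1 - (1 - \<eta>) powr (1 / p)"
  have l: "0 < l" "l < 1"
    using \<eta> p powr_less_mono2[of "1 / p" "1 - \<eta>" 1] by (auto simp: l_def)
  have lp: "(1 - l) powr p = 1 - \<eta>" using \<eta> p by (simp add: l_def powr_powr)
  have "degree_norm p (edges_meeting H A)
      \<le> (2 * real r) powr \<gamma> * real t powr (p * (real r - 1) - \<gamma>) * ?N"
    using card_high_degree[OF finite_verts[OF rH] N(1) _ N(2), of "real t"] t
    by (intro degree_norm_edges_meeting rH r p \<gamma> ext t) (auto simp: A_def)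
  also have "\<dots> \<le> \<eta> * l powr p * ?N"
    using t_large by (intro mult_right_mono degree_norm_nonneg) (simp add: l_def)
  finally have "degree_norm p (edges_meeting H A) / l powr p \<le> \<eta> * ?N"
    using l by (simp add: field_simps)
  moreover have "?N \<le> degree_norm p F / (1 - l) powr p + degree_norm p (edges_meeting H A) / l powr p"
    unfolding F_def
    by (rule degree_norm_split[OF r_graph_edges_avoiding[OF rH] r_graph_edges_meeting[OF rH] _ _ _ p l])
      (auto simp: edges_avoiding_def edges_meeting_def)
  ultimately have "(1 - \<eta>) * ?N \<le> degree_norm p F / (1 - \<eta>)"
    by (simp add: lp algebra_simps)
  then have norm: "(1 - \<eta>)\<^sup>2 * ?N \<le> degree_norm p F"
    using \<eta> by (simp add: power2_eq_square pos_le_divide_eq mult_ac)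
  have deg: "real (degree F v) powr p \<le> real t * ?N / ?m" for v
  proof (cases "v \<in> verts H - A")
    case True
    have "degree F v \<le> degree H v"
      unfolding degree_def F_def edges_avoiding_def
      using finite_edges[OF rH] by (intro card_mono) auto
    then have "real (degree F v) powr p \<le> real (degree H v) powr p"
      using p by (intro powr_mono2) auto
    also have "\<dots> \<le> real t * ?N / ?m" using True by (auto simp: A_def)
    finally show ?thesis .
  next
    case False
    then have none: "{e \<in> edges F. v \<in> e} = {}"
      using rH by (auto simp: F_def edges_avoiding_def r_graph_def)
    show ?thesis unfolding degree_def none using N by simp
  qed
  show ?thesis
    using r_graph_edges_avoiding[OF rH, of A] norm deg
    by (intro that[of F]) (auto simp: F_def subgraph_def edges_avoiding_def)
qed

lemma exists_large_parameter:
  fixes a c s :: real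
  assumes "s < 0" "0 < c"
  obtains t :: nat where "0 < t" "a * real t powr s \<le> c"
proof -
  have "(\<lambda>t. a * real t powr s) \<longlonglongrightarrow> a * 0"
    by (intro tendsto_mult tendsto_const tendsto_neg_powr[OF assms(1)] filterlim_real_sequentially)
  then have "eventually (\<lambda>t. a * real t powr s < c) sequentially"
    using assms(2) by (intro order_tendstoD(2)) auto
  then have "eventually (\<lambda>t. 0 < t \<and> a * real t powr s < c) sequentially"
    using eventually_gt_at_top[of 0] by eventually_elim auto
  then obtain t where "0 < t" "a * real t powr s < c"
    using eventually_happens[of _ sequentially] by auto
  then show ?thesis using that by simp
qed

section \<open>Edge count and order of the extremal subgraph\<close>

text \<open>
  The bound of \<open>degree_norm_le_edges\<close> solved for the number of edges. Inserting the bound on the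
  maximum degree puts the norm to the power \<open>(p - 1) / p\<close> on the right, and the power
  \<open>1 / p\<close> remains on the left.
\<close>

lemma card_edges_ge:
  assumes rH: "r_graph r H" and r: "1 \<le> r" and p: "1 \<le> p" and L: "0 < L"
    and m: "0 < card (verts H)" and N: "0 < degree_norm p H"
    and deg: "real (max_degree H) \<le> (L * (degree_norm p H / real (card (verts H)))) powr (1 / p)"
  shows "degree_norm p H powr (1 / p) * real (card (verts H)) powr ((p - 1) / p)
    \<le> real r * L powr ((p - 1) / p) * real (card (edges H))"
proof -
  let ?m = "real (card (verts H))"
  let ?N = "degree_norm p H"
  let ?E = "real (card (edges H))"
  have "?N \<le> real (max_degree H) powr (p - 1) * (real r * ?E)"
    by (rule degree_norm_le_edges[OF rH p])
  also have "\<dots> \<le> ((L * (?N / ?m)) powr (1 / p)) powr (p - 1) * (real r * ?E)"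
    using deg p by (intro mult_right_mono powr_mono2) auto
  also have "\<dots> = L powr ((p - 1) / p) * ?N powr ((p - 1) / p) / ?m powr ((p - 1) / p) * (real r * ?E)"
    using L N m by (simp add: powr_powr powr_mult powr_divide)
  finally have "?N * ?m powr ((p - 1) / p)
      \<le> ?N powr ((p - 1) / p) * (real r * L powr ((p - 1) / p) * ?E)"
    using m by (simp add: field_simps)
  moreover have "?N = ?N powr ((p - 1) / p) * ?N powr (1 / p)"
    using N p by (simp add: field_simps flip: powr_add)
  ultimately have "?N powr ((p - 1) / p) * (?N powr (1 / p) * ?m powr ((p - 1) / p))
      \<le> ?N powr ((p - 1) / p) * (real r * L powr ((p - 1) / p) * ?E)"
    by (metis mult.assoc)
  then show ?thesis using N by simp
qed

text \<open>
  The loss \<open>c\<close> enters to the power \<open>1 / p\<close> through the norm and to the power \<open>(p - 1) / p\<close> through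
  the degree bound, together exactly once.
\<close>

lemma card_edges_gt:
  assumes rH: "r_graph r H" and r: "1 \<le> r" and p: "1 \<le> p" and K: "0 < K" and c: "0 < c" and C: "0 < C"
    and m: "0 < card (verts H)"
    and N: "c * C * real (card (verts H)) powr (1 + p * \<alpha>) < degree_norm p H"
    and deg: "real (max_degree H) \<le> (K / c * (degree_norm p H / real (card (verts H)))) powr (1 / p)"
  shows "c * C powr (1 / p) / (real r * K powr ((p - 1) / p)) * real (card (verts H)) powr (1 + \<alpha>)
    < real (card (edges H))"
proof -
  let ?m = "real (card (verts H))"
  let ?q = "(p - 1) / p"
  have q: "1 / p + ?q = 1" using p by (simp add: field_simps)
  have pos: "0 < c * C * ?m powr (1 + p * \<alpha>)" using c C m by simp
  have exps: "(1 + p * \<alpha>) * (1 / p) + ?q = 1 + \<alpha>" using p by (simp add: field_simps)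
  have "c * C powr (1 / p) * ?m powr (1 + \<alpha>)
      = c powr (1 / p) * c powr ?q * C powr (1 / p) * (?m powr ((1 + p * \<alpha>) * (1 / p)) * ?m powr ?q)"
    using c by (simp only: q exps flip: powr_add) simp
  also have "\<dots> = (c * C * ?m powr (1 + p * \<alpha>)) powr (1 / p) * ?m powr ?q * c powr ?q"
    using c C m by (simp add: powr_mult powr_powr)
  also have "\<dots> < degree_norm p H powr (1 / p) * ?m powr ?q * c powr ?q"
    using N pos m c p by (intro mult_strict_right_mono powr_less_mono2) auto
  also have "\<dots> \<le> real r * (K / c) powr ?q * real (card (edges H)) * c powr ?q"
    using pos N K c deg m by (intro mult_right_mono card_edges_ge[OF rH r p]) auto
  also have "\<dots> = real r * K powr ?q * real (card (edges H))"
    using K c by (simp add: powr_divide)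
  finally show ?thesis using r K by (simp add: field_simps)
qed

lemma order_ge:
  fixes C \<delta> n m :: real
  assumes "0 < \<delta>" "3 * \<delta> < 1" "0 < C" "0 < n" "0 < m"
    and "C * n powr \<delta> \<le> m powr (1 - 3 * \<delta>)"
  shows "(C powr (1 / \<delta>) * n) powr (\<delta> / (1 - 3 * \<delta>)) \<le> m"
proof -
  have "(C powr (1 / \<delta>) * n) powr (\<delta> / (1 - 3 * \<delta>)) = (C * n powr \<delta>) powr (1 / (1 - 3 * \<delta>))"
    using assms(1-4) by (simp add: powr_mult powr_powr)
  also have "\<dots> \<le> (m powr (1 - 3 * \<delta>)) powr (1 / (1 - 3 * \<delta>))"
    using assms by (intro powr_mono2) auto
  also have "\<dots> = m" using assms by (simp add: powr_powr)
  finally show ?thesis .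
qed

text \<open>
  The exponent \<open>\<gamma> = p * (r - 1) + 3 * \<delta>\<close> lies between two others. It is below \<open>1 + p * \<alpha>\<close> by
  \<open>\<delta>\<close>, so passing from \<open>n\<close> to \<open>m\<close> vertices gains the factor \<open>(n / m) powr \<delta>\<close> over the density
  wanted. It is below the exponent \<open>1 + p * (r - 1)\<close> of the trivial bound by \<open>1 - 3 * \<delta>\<close>, which
  keeps the maximiser from being too small.
\<close>

lemma extremal_subgraph:
  assumes rG: "r_graph r G" and r: "1 \<le> r" and p: "1 \<le> p" and C: "0 < C"
    and n: "0 < card (verts G)"
    and \<delta>: "0 < \<delta>" "3 * \<delta> < 1" "p * (real r - 1) + 4 * \<delta> = 1 + p * \<alpha>"
    and G: "C * real (card (verts G)) powr (1 + p * \<alpha>) \<le> degree_norm p G"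
  obtains H where "r_graph r H" "subgraph H G" "verts H \<noteq> {}"
    and "C * real (card (verts H)) powr (1 + p * \<alpha>) \<le> degree_norm p H"
    and "(C powr (1 / \<delta>) * real (card (verts G))) powr (\<delta> / (1 - 3 * \<delta>)) \<le> real (card (verts H))"
    and "\<And>U. U \<subseteq> verts H \<Longrightarrow> degree_norm p (induced H U)
      \<le> (real (card U) / real (card (verts H))) powr (p * (real r - 1) + 3 * \<delta>) * degree_norm p H"
proof -
  define \<gamma> where "\<gamma> = p * (real r - 1) + 3 * \<delta>"
  have \<gamma>: "1 + p * \<alpha> = \<gamma> + \<delta>" "1 + p * (real r - 1) = \<gamma> + (1 - 3 * \<delta>)" using \<delta> by (simp_all add: \<gamma>_def)
  let ?V = "verts G"
  let ?n = "real (card ?V)"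
  have fV: "finite ?V" and ne: "?V \<noteq> {}" using n by (auto simp: card_gt_0_iff)
  have GG: "degree_norm p (induced G ?V) = degree_norm p G"
  proof -
    have "edges (induced G ?V) = edges G" using rG by (auto simp: induced_def r_graph_def)
    then show ?thesis by (simp add: degree_norm_def degree_def) (simp add: induced_def)
  qed
  obtain W where W: "W \<subseteq> ?V" "W \<noteq> {}"
    and low: "degree_norm p (induced G W) \<ge> (real (card W) / ?n) powr \<gamma> * degree_norm p (induced G ?V)"
    and ext: "\<And>U. U \<subseteq> W \<Longrightarrow>
      degree_norm p (induced G U) \<le> (real (card U) / real (card W)) powr \<gamma> * degree_norm p (induced G W)"
    using exists_extremal_set[OF fV ne] by blast
  define H where "H = induced G W"
  have vH: "verts H = W" by (simp add: H_def induced_def)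
  let ?m = "real (card W)"
  have m: "0 < ?m" using W fV by (simp add: card_gt_0_iff finite_subset)
  have mn: "?m \<le> ?n" using W fV by (simp add: card_mono)
  have rH: "r_graph r H" unfolding H_def by (rule r_graph_induced[OF rG W(1)])
  have "C * ?n powr \<delta> * ?m powr \<gamma> = (?m / ?n) powr \<gamma> * (C * ?n powr (1 + p * \<alpha>))"
    using n by (simp add: \<gamma> powr_add powr_divide)
  also have "\<dots> \<le> (?m / ?n) powr \<gamma> * degree_norm p (induced G ?V)"
    unfolding GG by (intro mult_left_mono G) auto
  also have "\<dots> \<le> degree_norm p H" using low by (simp add: H_def)
  finally have H: "C * ?n powr \<delta> * ?m powr \<gamma> \<le> degree_norm p H" .
  have "C * ?m powr (1 + p * \<alpha>) = C * ?m powr \<delta> * ?m powr \<gamma>" by (simp add: \<gamma> powr_add)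
  also have "\<dots> \<le> C * ?n powr \<delta> * ?m powr \<gamma>"
    using C \<delta> mn by (intro mult_right_mono mult_left_mono powr_mono2) auto
  also note H
  finally have norm: "C * ?m powr (1 + p * \<alpha>) \<le> degree_norm p H" .
  have "C * ?n powr \<delta> * ?m powr \<gamma> \<le> ?m powr (1 - 3 * \<delta>) * ?m powr \<gamma>"
  proof -
    have "degree_norm p H \<le> ?m powr (\<gamma> + (1 - 3 * \<delta>))"
      using degree_norm_le[OF rH r, of p] p m unfolding vH \<gamma>(2) by simp
    also have "\<dots> = ?m powr (1 - 3 * \<delta>) * ?m powr \<gamma>" by (simp add: powr_add)
    finally show ?thesis using H by linarith
  qed
  then have "C * ?n powr \<delta> \<le> ?m powr (1 - 3 * \<delta>)" using m by simp
  then have ord: "(C powr (1 / \<delta>) * ?n) powr (\<delta> / (1 - 3 * \<delta>)) \<le> ?m"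
    using \<delta> C n m by (intro order_ge) auto
  have "induced H U = induced G U" if "U \<subseteq> W" for U
    using that by (auto simp: H_def induced_def)
  then show ?thesis
    using that[of H] rH W norm ord ext by (auto simp: vH \<gamma>_def subgraph_def) (auto simp: H_def induced_def)
qed

theorem lemma3p1:
  fixes r :: nat and \<alpha> p C :: real
  assumes "r \<ge> 2"
    and "real r - 2 < \<alpha>" and "\<alpha> < real r - 1"
    and "1 \<le> p" and "p < 1 / (real r - 1 - \<alpha>)"
    and "C > 0"
  shows "\<forall>\<epsilon>::real. 0 < \<epsilon> \<and> \<epsilon> < 1 \<longrightarrow>
    (\<exists>(K::real) (N\<^sub>0::nat). K > 0 \<and>
      (\<forall>n\<ge>N\<^sub>0. \<forall>G :: 'a hypergraph.
        r_graph r G \<and> card (verts G) = n \<and>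
        degree_norm p G \<ge> C * real n powr (1 + p * \<alpha>) \<longrightarrow>
        (\<exists>(H :: 'a hypergraph) (m::nat).
          r_graph r H \<and> subgraph H G \<and> card (verts H) = m \<and>
          degree_norm p H \<ge> (1 - \<epsilon>) * C * real m powr (1 + p * \<alpha>) \<and>
          (let \<delta> = (1 - p * (real r - 1 - \<alpha>)) / 4
           in real m \<ge> (C powr (1 / \<delta>) * real n) powr (\<delta> / (1 - 3 * \<delta>)) / 2) \<and>
          real (max_degree H) \<le> (K / (1 - \<epsilon>) * (degree_norm p H / real m)) powr (1 / p) \<and>
          (let C' = (1 - \<epsilon>) * C powr (1 / p) / (real r * K powr ((p - 1) / p))
           in real (card (edges H)) > C' * real m powr (1 + \<alpha>)))))"
proof (intro allI impI)
  fix \<epsilon> :: real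
  assume \<epsilon>: "0 < \<epsilon> \<and> \<epsilon> < 1"
  define \<delta> where "\<delta> = (1 - p * (real r - 1 - \<alpha>)) / 4"
  define \<gamma> where "\<gamma> = p * (real r - 1) + 3 * \<delta>"
  \<comment> \<open>The deletion costs a factor \<open>(1 - \<eta>)\<^sup>2\<close>, which must stay strictly above \<open>1 - \<epsilon>\<close>.\<close>
  define \<eta> where "\<eta> = \<epsilon> / 4"
  have r: "1 \<le> r" using assms(1) by simp
  have p: "1 \<le> p" by fact
  have gap: "0 < p * (real r - 1 - \<alpha>)" "p * (real r - 1 - \<alpha>) < 1"
    using assms(3-5) by (simp_all add: pos_less_divide_eq)
  have \<delta>: "0 < \<delta>" "3 * \<delta> < 1" "p * (real r - 1) + 4 * \<delta> = 1 + p * \<alpha>"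
    using gap by (simp_all add: \<delta>_def field_simps)
  have \<gamma>: "0 \<le> \<gamma>" using r p \<delta> by (simp add: \<gamma>_def)
  have \<eta>: "0 < \<eta>" "\<eta> < 1" using \<epsilon> by (simp_all add: \<eta>_def)
  have "(1 - \<eta>) powr (1 / p) < 1"
    using \<eta> p powr_less_mono2[of "1 / p" "1 - \<eta>" 1] by auto
  then have margin: "0 < \<eta> * (1 - (1 - \<eta>) powr (1 / p)) powr p"
    using \<eta>(1) by (metis diff_gt_0_iff_gt less_irrefl mult_pos_pos powr_gt_zero)
  have exponent: "p * (real r - 1) - \<gamma> < 0" using \<delta> by (simp add: \<gamma>_def)
  obtain t :: nat where t: "0 < t"
    and t_large: "(2 * real r) powr \<gamma> * real t powr (p * (real r - 1) - \<gamma>)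
      \<le> \<eta> * (1 - (1 - \<eta>) powr (1 / p)) powr p"
    by (rule exists_large_parameter[OF exponent margin])
  have sq: "1 - \<epsilon> < (1 - \<eta>)\<^sup>2" using \<epsilon> by (simp add: \<eta>_def power2_eq_square algebra_simps add_pos_pos)
  show "\<exists>(K::real) (N\<^sub>0::nat). K > 0 \<and>
      (\<forall>n\<ge>N\<^sub>0. \<forall>G :: 'a hypergraph.
        r_graph r G \<and> card (verts G) = n \<and>
        degree_norm p G \<ge> C * real n powr (1 + p * \<alpha>) \<longrightarrow>
        (\<exists>(H :: 'a hypergraph) (m::nat).
          r_graph r H \<and> subgraph H G \<and> card (verts H) = m \<and>
          degree_norm p H \<ge> (1 - \<epsilon>) * C * real m powr (1 + p * \<alpha>) \<and>
          (let \<delta> = (1 - p * (real r - 1 - \<alpha>)) / 4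
           in real m \<ge> (C powr (1 / \<delta>) * real n) powr (\<delta> / (1 - 3 * \<delta>)) / 2) \<and>
          real (max_degree H) \<le> (K / (1 - \<epsilon>) * (degree_norm p H / real m)) powr (1 / p) \<and>
          (let C' = (1 - \<epsilon>) * C powr (1 / p) / (real r * K powr ((p - 1) / p))
           in real (card (edges H)) > C' * real m powr (1 + \<alpha>))))"
    \<comment> \<open>The threshold 1 makes the norm of \<open>G\<close> positive.\<close>
  proof (intro exI[of _ "real t"] exI[of _ "1::nat"] conjI allI impI, goal_cases)
    case 1
    show ?case using t by simp
  next
    case (2 n G)
    then have rG: "r_graph r G" and n: "card (verts G) = n" "0 < card (verts G)"
      and G: "C * real (card (verts G)) powr (1 + p * \<alpha>) \<le> degree_norm p G" by auto
    obtain H where rH: "r_graph r H" and HG: "subgraph H G" and neH: "verts H \<noteq> {}"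
      and NH: "C * real (card (verts H)) powr (1 + p * \<alpha>) \<le> degree_norm p H"
      and ord: "(C powr (1 / \<delta>) * real (card (verts G))) powr (\<delta> / (1 - 3 * \<delta>)) \<le> real (card (verts H))"
      and ext: "\<And>U. U \<subseteq> verts H \<Longrightarrow> degree_norm p (induced H U)
        \<le> (real (card U) / real (card (verts H))) powr (p * (real r - 1) + 3 * \<delta>) * degree_norm p H"
      using extremal_subgraph[OF rG r p assms(6) n(2) \<delta> G] by blast
    define m where "m = card (verts H)"
    have m: "0 < m" using neH finite_verts[OF rH] by (simp add: m_def card_gt_0_iff)
    have NHpos: "0 < degree_norm p H"
      using NH m assms(6) by (intro less_le_trans[OF _ NH]) (simp add: m_def)
    obtain F where rF: "r_graph r F" and FH: "subgraph F H" and vF: "verts F = verts H"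
      and NF: "(1 - \<eta>)\<^sup>2 * degree_norm p H \<le> degree_norm p F"
      and dF: "\<And>v. real (degree F v) powr p \<le> real t * degree_norm p H / real (card (verts H))"
      using delete_high_degree[OF rH r p \<gamma> t \<eta> NHpos neH ext[folded \<gamma>_def] t_large] by blast
    have NHF: "(1 - \<epsilon>) * degree_norm p H < degree_norm p F"
      using mult_strict_right_mono[OF sq NHpos] NF by linarith
    have NF': "(1 - \<epsilon>) * C * real m powr (1 + p * \<alpha>) < degree_norm p F"
    proof -
      have "(1 - \<epsilon>) * (C * real m powr (1 + p * \<alpha>)) \<le> (1 - \<epsilon>) * degree_norm p H"
        using NH \<epsilon> by (intro mult_left_mono) (auto simp: m_def)
      then show ?thesis using NHF by (simp add: mult.assoc)
    qed
    have md: "real (max_degree F) \<le> (real t / (1 - \<epsilon>) * (degree_norm p F / real m)) powr (1 / p)"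
    proof (rule max_degree_le)
      fix v
      have "real t * degree_norm p H / real m \<le> real t * (degree_norm p F / (1 - \<epsilon>)) / real m"
        using NHF \<epsilon> by (intro divide_right_mono mult_left_mono) (auto simp: field_simps)
      then have "real (degree F v) powr p \<le> real t / (1 - \<epsilon>) * (degree_norm p F / real m)"
        using dF[of v] by (simp add: m_def)
      then have "(real (degree F v) powr p) powr (1 / p)
          \<le> (real t / (1 - \<epsilon>) * (degree_norm p F / real m)) powr (1 / p)"
        using p by (intro powr_mono2) auto
      then show "real (degree F v) \<le> (real t / (1 - \<epsilon>) * (degree_norm p F / real m)) powr (1 / p)"
        using p by (simp add: powr_powr)
    qed (use finite_verts[OF rF] in auto)
    have "(1 - \<epsilon>) * C powr (1 / p) / (real r * real t powr ((p - 1) / p)) * real m powr (1 + \<alpha>)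
        < real (card (edges F))"
      using card_edges_gt[OF rF r p, of "real t" "1 - \<epsilon>" C \<alpha>] t \<epsilon> assms(6) m NF' md
      by (simp add: vF m_def)
    moreover have "(C powr (1 / \<delta>) * real n) powr (\<delta> / (1 - 3 * \<delta>)) / 2 \<le> real m"
      using ord n by (simp add: m_def)
    moreover have "subgraph F G" using FH HG by (auto simp: subgraph_def)
    ultimately show ?case
      using rF vF NF' md unfolding Let_def
      by (intro exI[of _ F] exI[of _ m]) (simp add: m_def flip: \<delta>_def)
  qed
qed

end
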